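(* Let $d\geq 1$ and let $G$ be a graph that is $(d+1)$-connected and redundantly rigid in $\mathbb{R}^d$. Suppose that $G$ is $M$-separable in $\mathbb{R}^d$ and let $H_1,\dots,H_q$ be the $M$-connected components of $G$ in $\mathbb{R}^d$. Then $\sum_{i=1}^q\mathrm{dof}_d(H_i)\geq\binom{d+1}{2}$.
   Context: A graph is $k$-connected if it has at least $k+1$ vertices and remains connected after deleting fewer than $k$ vertices. The $d$-dimensional rigidity matroid $\mathcal{R}_d(G)$ on $E(G)$ is given by linear independence of rows of the rigidity matrix of a generic realization (row of edge $uv$: $p(u)-p(v)$ in the columns of $u$, $p(v)-p(u)$ in those of $v$, zeros elsewhere), with rank function $r_d$. $G$ is rigid in $\mathbb{R}^d$ if (for $|V|\geq d+1$) $r_d(G)=d|V|-\binom{d+1}{2}$, and redundantly rigid if $G-e$ is rigid for every edge $e$. $G$ is $M$-separable in $\mathbb{R}^d$ if $\mathcal{R}_d(G)$ is not connected; its $M$-connected components are the subgraphs induced by the edge sets of the connected components of $\mathcal{R}_d(G)$ (equivalence classes of the relation "$e=f$ or $e,f$ lie in a common circuit"). For a graph $H$, $\mathrm{dof}_d(H)=d|V(H)|-\binom{d+1}{2}-r_d(H)$. *)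

theory Defs
  imports Complex_Main
begin

(* Finite simple graphs: vertex set V, edges = 2-element subsets of V. *)
definition simple_graph :: "'a set \<Rightarrow> 'a set set \<Rightarrow> bool" where
  "simple_graph V E \<longleftrightarrow> finite V \<and> (\<forall>e\<in>E. e \<subseteq> V \<and> card e = 2)"

(* connectivity of the subgraph induced on W *)
definition adj_in :: "'a set \<Rightarrow> 'a set set \<Rightarrow> ('a \<times> 'a) set" where
  "adj_in W E = {(u,v). u \<in> W \<and> v \<in> W \<and> {u,v} \<in> E}"

definition graph_connected :: "'a set \<Rightarrow> 'a set set \<Rightarrow> bool" where
  "graph_connected W E \<longleftrightarrow> (\<forall>u\<in>W. \<forall>v\<in>W. (u,v) \<in> (adj_in W E)\<^sup>*)"

definition k_connected :: "nat \<Rightarrow> 'a set \<Rightarrow> 'a set set \<Rightarrow> bool" where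
  "k_connected k V E \<longleftrightarrow> card V \<ge> k + 1 \<and>
     (\<forall>S. S \<subseteq> V \<and> card S < k \<longrightarrow> graph_connected (V - S) E)"

(* Realizations p : vertex -> R^d, coordinates indexed by i < d.
   Row of edge e={u,v} of the rigidity matrix: at column (w,i), w in e:
   p(w)_i - p(other)_i  (= sum over x in e of p(w)_i - p(x)_i); zero elsewhere. *)
definition rig_row :: "nat \<Rightarrow> ('a \<Rightarrow> nat \<Rightarrow> real) \<Rightarrow> 'a set \<Rightarrow> 'a \<Rightarrow> nat \<Rightarrow> real" where
  "rig_row d p e w i = (if w \<in> e \<and> i < d then (\<Sum>x\<in>e. p w i - p x i) else 0)"

(* rows of the edges in F are linearly independent (as a family) *)
definition rows_indep :: "nat \<Rightarrow> ('a \<Rightarrow> nat \<Rightarrow> real) \<Rightarrow> 'a set set \<Rightarrow> bool" where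
  "rows_indep d p F \<longleftrightarrow> finite F \<and>
     (\<forall>c. (\<forall>w i. (\<Sum>e\<in>F. c e * rig_row d p e w i) = 0) \<longrightarrow> (\<forall>e\<in>F. c e = 0))"

(* Independence in the d-dimensional rigidity matroid: independent rows for a
   generic realization, i.e. (equivalently, generic rank = maximum rank)
   independent rows for some realization. *)
definition R_indep :: "nat \<Rightarrow> 'a set set \<Rightarrow> bool" where
  "R_indep d F \<longleftrightarrow> (\<exists>p. rows_indep d p F)"

(* rank function r_d *)
definition rank_d :: "nat \<Rightarrow> 'a set set \<Rightarrow> nat" where
  "rank_d d F = Max {card F' | F'. F' \<subseteq> F \<and> R_indep d F'}"

definition R_circuit :: "nat \<Rightarrow> 'a set set \<Rightarrow> bool" where
  "R_circuit d C \<longleftrightarrow> \<not> R_indep d C \<and> (\<forall>C'. C' \<subset> C \<longrightarrow> R_indep d C')"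

definition rigid :: "nat \<Rightarrow> 'a set \<Rightarrow> 'a set set \<Rightarrow> bool" where
  "rigid d V E \<longleftrightarrow>
     (if card V \<ge> d + 1 then int (rank_d d E) = int d * int (card V) - int ((d+1) choose 2)
      else (\<forall>u\<in>V. \<forall>v\<in>V. u \<noteq> v \<longrightarrow> {u,v} \<in> E))"

definition redundantly_rigid :: "nat \<Rightarrow> 'a set \<Rightarrow> 'a set set \<Rightarrow> bool" where
  "redundantly_rigid d V E \<longleftrightarrow> (\<forall>e\<in>E. rigid d V (E - {e}))"

(* the relation "e = f or e, f lie in a common circuit" on the ground set E *)
definition M_rel :: "nat \<Rightarrow> 'a set set \<Rightarrow> ('a set \<times> 'a set) set" where
  "M_rel d E = {(e,f). e \<in> E \<and> f \<in> E \<and>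
      (e = f \<or> (\<exists>C. C \<subseteq> E \<and> R_circuit d C \<and> e \<in> C \<and> f \<in> C))}"

definition M_separable :: "nat \<Rightarrow> 'a set set \<Rightarrow> bool" where
  "M_separable d E \<longleftrightarrow> \<not> (\<forall>e\<in>E. \<forall>f\<in>E. (e,f) \<in> M_rel d E)"

(* edge sets of the M-connected components *)
definition M_components :: "nat \<Rightarrow> 'a set set \<Rightarrow> 'a set set set" where
  "M_components d E = E // M_rel d E"

(* dof_d(H) for a graph H = (VH, EH) *)
definition dof :: "nat \<Rightarrow> 'a set \<Rightarrow> 'a set set \<Rightarrow> int" where
  "dof d VH EH = int d * int (card VH) - int ((d+1) choose 2) - int (rank_d d EH)"

end

theory Submission
  imports Defs "HOL-Computational_Algebra.Polynomial"
begin

text \<open>Since the rank is additive over the \<open>M\<close>-connected components and \<open>G\<close> is rigid,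
  the sum of the degrees of freedom equals
  \<open>d * (\<Sum>v. s v - 1) - (q - 1) * binomial (d + 1) 2\<close>, where \<open>s v\<close> is the number of components
  containing \<open>v\<close>. Redundant rigidity puts every edge in a circuit, so every component has at least
  \<open>d + 2\<close> vertices; \<open>(d + 1)\<close>-connectivity then forces every component to share at least \<open>d + 1\<close>
  vertices with the others. As \<open>s v - 1 \<ge> s v / 2\<close> for shared vertices, double counting gives
  \<open>(\<Sum>v. s v - 1) \<ge> q * (d + 1) / 2\<close>, which is the claim.

  Independence over some realization behaves like linear independence at one generic realization,
  because along a line of realizations an independent family becomes dependent for only finitely
  many parameters.\<close>

section \<open>Linearly independent families\<close>

text \<open>Independence is that of the indexed family, not of its set of values: two indices
  carrying equal rows are dependent.\<close>

definition indep_fam :: "'i set \<Rightarrow> ('i \<Rightarrow> 'j \<Rightarrow> real) \<Rightarrow> bool" where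
  "indep_fam I a \<longleftrightarrow> (\<forall>c. (\<forall>j. (\<Sum>i\<in>I. c i * a i j) = 0) \<longrightarrow> (\<forall>i\<in>I. c i = 0))"

lemma indep_famD:
  assumes "indep_fam I a" "\<And>j. (\<Sum>i\<in>I. c i * a i j) = 0" "i \<in> I"
  shows "c i = 0"
  using assms unfolding indep_fam_def by blast

text \<open>One step of Gaussian elimination with pivot \<open>a i0 j0\<close>. Rows are
  cross-multiplied instead of divided, so polynomial entries stay polynomial.\<close>

lemma indep_fam_eliminate:
  assumes fin: "finite I" and i0: "i0 \<in> I" and nz: "a i0 j0 \<noteq> 0"
  shows "indep_fam I a \<longleftrightarrow>
    indep_fam (I - {i0}) (\<lambda>i j. a i0 j0 * a i j - a i j0 * a i0 j)"
proof
  assume ind: "indep_fam I a"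
  show "indep_fam (I - {i0}) (\<lambda>i j. a i0 j0 * a i j - a i j0 * a i0 j)"
    unfolding indep_fam_def
  proof (intro allI impI ballI)
    fix c i
    assume c: "\<forall>j. (\<Sum>i\<in>I - {i0}. c i * (a i0 j0 * a i j - a i j0 * a i0 j)) = 0"
      and i: "i \<in> I - {i0}"
    \<comment> \<open>The coefficient of the pivot row collects the multiples of that row subtracted
      from the others.\<close>
    define c' where "c' i = (if i = i0 then - (\<Sum>i\<in>I - {i0}. c i * a i j0) else a i0 j0 * c i)" for i
    have "(\<Sum>i\<in>I. c' i * a i j) = 0" for j
    proof -
      have "(\<Sum>i\<in>I. c' i * a i j) = c' i0 * a i0 j + (\<Sum>i\<in>I - {i0}. c' i * a i j)"
        using fin i0 by (rule sum.remove)
      also have "(\<Sum>i\<in>I - {i0}. c' i * a i j) = (\<Sum>i\<in>I - {i0}. a i0 j0 * c i * a i j)"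
        by (rule sum.cong) (auto simp: c'_def)
      also have "c' i0 * a i0 j = - (\<Sum>i\<in>I - {i0}. c i * a i j0 * a i0 j)"
        by (simp add: c'_def sum_distrib_right)
      also have "\<dots> + (\<Sum>i\<in>I - {i0}. a i0 j0 * c i * a i j) =
          (\<Sum>i\<in>I - {i0}. c i * (a i0 j0 * a i j - a i j0 * a i0 j))"
        by (simp add: sum_subtractf algebra_simps)
      finally show ?thesis using c by simp
    qed
    then have "c' i = 0" using i indep_famD[OF ind, of c' i] by blast
    then show "c i = 0" using i nz by (auto simp: c'_def)
  qed
next
  assume ind: "indep_fam (I - {i0}) (\<lambda>i j. a i0 j0 * a i j - a i j0 * a i0 j)"
  show "indep_fam I a"
    unfolding indep_fam_def
  proof (intro allI impI)
    fix c
    assume c: "\<forall>j. (\<Sum>i\<in>I. c i * a i j) = 0"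
    have rest: "(\<Sum>i\<in>I - {i0}. c i * a i j) = - (c i0 * a i0 j)" for j
      using c sum.remove[OF fin i0, of "\<lambda>i. c i * a i j"] by (simp add: add_eq_0_iff)
    have "(\<Sum>i\<in>I - {i0}. c i * (a i0 j0 * a i j - a i j0 * a i0 j)) = 0" for j
    proof -
      have "(\<Sum>i\<in>I - {i0}. c i * (a i0 j0 * a i j - a i j0 * a i0 j)) =
          a i0 j0 * (\<Sum>i\<in>I - {i0}. c i * a i j) - a i0 j * (\<Sum>i\<in>I - {i0}. c i * a i j0)"
        by (simp add: sum_subtractf sum_distrib_left algebra_simps)
      then show ?thesis by (simp add: rest)
    qed
    then have z: "c i = 0" if "i \<in> I - {i0}" for i
      using indep_famD[OF ind, of c] that by blast
    then have "c i0 * a i0 j0 = 0" using rest[of j0] by simp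
    then show "\<forall>i\<in>I. c i = 0" using z nz by auto
  qed
qed

lemma indep_fam_nonzero:
  assumes "indep_fam I a" "finite I" "i \<in> I"
  shows "\<exists>j. a i j \<noteq> 0"
proof (rule ccontr)
  assume "\<not> ?thesis"
  then have "(\<Sum>k\<in>I. (if k = i then 1 else 0) * a k j) = 0" for j
    by (intro sum.neutral) auto
  from indep_famD[OF assms(1) this assms(3)] show False by simp
qed

text \<open>Eliminating with a pivot in column \<open>j0\<close> makes that column vanish in all
  other rows, so each induction step removes one row and one column.\<close>

lemma indep_fam_card_le:
  assumes "finite I" "finite J" "indep_fam I a" "\<And>i j. i \<in> I \<Longrightarrow> j \<notin> J \<Longrightarrow> a i j = 0"
  shows "card I \<le> card J"
  using assms
proof (induction I arbitrary: J a rule: finite_induct)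
  case empty
  then show ?case by simp
next
  case (insert i0 I)
  obtain j0 where j0: "a i0 j0 \<noteq> 0"
    using indep_fam_nonzero[OF insert.prems(2), of i0] insert.hyps by auto
  then have "j0 \<in> J" using insert.prems(3) by blast
  have "indep_fam (insert i0 I - {i0}) (\<lambda>i j. a i0 j0 * a i j - a i j0 * a i0 j)"
    using indep_fam_eliminate[of "insert i0 I" i0 a j0] insert.hyps insert.prems j0 by blast
  then have "card I \<le> card (J - {j0})"
    using insert.hyps insert.prems
    by (intro insert.IH[of _ "\<lambda>i j. a i0 j0 * a i j - a i j0 * a i0 j"]) auto
  then show ?case
    using insert.hyps insert.prems \<open>j0 \<in> J\<close>
    by (metis card_Suc_Diff1 card_insert_disjoint Suc_le_mono)
qed

text \<open>A pivot polynomial that is nonzero at \<open>t0\<close> has finitely many roots. Away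
  from them, elimination reduces the question to a smaller family that again has polynomial
  entries.\<close>

lemma finite_dependent_parameters:
  assumes "finite I" "indep_fam I (\<lambda>i j. poly (P i j) t0)"
  shows "finite {t. \<not> indep_fam I (\<lambda>i j. poly (P i j) t)}"
  using assms
proof (induction I arbitrary: P rule: finite_induct)
  case empty
  then show ?case by (simp add: indep_fam_def)
next
  case (insert i0 I)
  obtain j0 where j0: "poly (P i0 j0) t0 \<noteq> 0"
    using indep_fam_nonzero[OF insert.prems, of i0] insert.hyps by auto
  define Q where "Q i j = P i0 j0 * P i j - P i j0 * P i0 j" for i j
  have elim: "indep_fam (insert i0 I) (\<lambda>i j. poly (P i j) t) \<longleftrightarrow>
      indep_fam I (\<lambda>i j. poly (Q i j) t)" if "poly (P i0 j0) t \<noteq> 0" for t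
    using indep_fam_eliminate[of "insert i0 I" i0 "\<lambda>i j. poly (P i j) t" j0]
      that insert.hyps by (simp add: Q_def)
  have "finite {t. \<not> indep_fam I (\<lambda>i j. poly (Q i j) t)}"
    using elim[OF j0] insert.prems by (intro insert.IH) simp
  moreover have "finite {t. poly (P i0 j0) t = 0}"
    using j0 by (intro poly_roots_finite) auto
  ultimately show ?case
    by (rule rev_finite_subset[OF finite_UnI]) (use elim in auto)
qed

lemma indep_fam_subset:
  assumes "indep_fam I a" "finite I" "D \<subseteq> I"
  shows "indep_fam D a"
  unfolding indep_fam_def
proof (intro allI impI ballI)
  fix c x
  assume c: "\<forall>j. (\<Sum>i\<in>D. c i * a i j) = 0" and x: "x \<in> D"
  have "(\<Sum>i\<in>I. (if i \<in> D then c i else 0) * a i j) = (\<Sum>i\<in>D. c i * a i j)" for j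
    using assms(2,3) by (intro sum.mono_neutral_cong_right) auto
  then have "(if x \<in> D then c x else 0) = 0"
    using c assms(3) x by (intro indep_famD[OF assms(1), of "\<lambda>i. if i \<in> D then c i else 0"]) auto
  then show "c x = 0" using x by simp
qed

section \<open>Circuits of a linear family\<close>

definition fam_circuit :: "('i \<Rightarrow> 'j \<Rightarrow> real) \<Rightarrow> 'i set \<Rightarrow> bool" where
  "fam_circuit a C \<longleftrightarrow> \<not> indep_fam C a \<and> (\<forall>C'. C' \<subset> C \<longrightarrow> indep_fam C' a)"

text \<open>Forcing coefficients to vanish outside \<open>U\<close> lets dependencies of different
  subsets of \<open>U\<close> be subtracted and compared by their supports; circuits are the minimal
  nonempty supports.\<close>

definition lin_dep :: "('i \<Rightarrow> 'j \<Rightarrow> real) \<Rightarrow> 'i set \<Rightarrow> ('i \<Rightarrow> real) \<Rightarrow> bool" where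
  "lin_dep a U c \<longleftrightarrow> (\<forall>x. x \<notin> U \<longrightarrow> c x = 0) \<and> (\<forall>j. (\<Sum>x\<in>U. c x * a x j) = 0)"

lemma not_indep_fam_iff:
  assumes "finite U" "D \<subseteq> U"
  shows "\<not> indep_fam D a \<longleftrightarrow> (\<exists>c. lin_dep a U c \<and> {x. c x \<noteq> 0} \<subseteq> D \<and> {x. c x \<noteq> 0} \<noteq> {})"
proof
  assume "\<not> indep_fam D a"
  then obtain c x where c: "\<And>j. (\<Sum>i\<in>D. c i * a i j) = 0" "x \<in> D" "c x \<noteq> 0"
    unfolding indep_fam_def by blast
  have "(\<Sum>i\<in>U. (if i \<in> D then c i else 0) * a i j) = (\<Sum>i\<in>D. c i * a i j)" for j
    using assms by (intro sum.mono_neutral_cong_right) auto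
  with c assms show "\<exists>c. lin_dep a U c \<and> {x. c x \<noteq> 0} \<subseteq> D \<and> {x. c x \<noteq> 0} \<noteq> {}"
    by (intro exI[of _ "\<lambda>i. if i \<in> D then c i else 0"]) (auto simp: lin_dep_def)
next
  assume "\<exists>c. lin_dep a U c \<and> {x. c x \<noteq> 0} \<subseteq> D \<and> {x. c x \<noteq> 0} \<noteq> {}"
  then obtain c x where c: "lin_dep a U c" "{x. c x \<noteq> 0} \<subseteq> D" "c x \<noteq> 0" by blast
  have "(\<Sum>i\<in>D. c i * a i j) = (\<Sum>i\<in>U. c i * a i j)" for j
    using assms c(2) by (intro sum.mono_neutral_left) auto
  then have "(\<Sum>i\<in>D. c i * a i j) = 0" for j
    using c(1) by (simp add: lin_dep_def)
  moreover have "x \<in> D" using c by blast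
  ultimately show "\<not> indep_fam D a"
    using indep_famD[of D a c x] c(3) by blast
qed

lemma lin_dep_cancel:
  assumes "lin_dep a U c" "lin_dep a U b"
  shows "lin_dep a U (\<lambda>x. c x - k * b x)"
proof -
  have "(\<Sum>x\<in>U. (c x - k * b x) * a x j) = (\<Sum>x\<in>U. c x * a x j) - k * (\<Sum>x\<in>U. b x * a x j)" for j
    by (simp add: sum_subtractf sum_distrib_left algebra_simps)
  with assms show ?thesis by (simp add: lin_dep_def)
qed

text \<open>The support of a nonzero dependency inside \<open>C\<close> is itself dependent, hence
  all of \<open>C\<close> by minimality.\<close>

lemma fam_circuit_lin_dep:
  assumes "finite U" "C \<subseteq> U" "fam_circuit a C"
  obtains c where "lin_dep a U c" "{x. c x \<noteq> 0} = C"
proof -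
  obtain c where c: "lin_dep a U c" "{x. c x \<noteq> 0} \<subseteq> C" "{x. c x \<noteq> 0} \<noteq> {}"
    using not_indep_fam_iff[OF assms(1,2), of a] assms(3) unfolding fam_circuit_def by blast
  have "\<not> indep_fam {x. c x \<noteq> 0} a"
    using not_indep_fam_iff[OF assms(1), of "{x. c x \<noteq> 0}" a] c assms(2) by blast
  then have "{x. c x \<noteq> 0} = C"
    using c(2) assms(3) unfolding fam_circuit_def by blast
  with c(1) that show thesis by blast
qed

text \<open>Descent on the size of the support: if it is not a circuit, it properly contains the
  support of another dependency \<open>b\<close>. Either \<open>b\<close> already involves
  \<open>e\<close>, or subtracting a multiple of \<open>b\<close> shrinks the support without
  changing the coefficient of \<open>e\<close>.\<close>

lemma fam_circuit_through:
  assumes "finite U" "lin_dep a U c" "c e \<noteq> 0"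
  shows "\<exists>C. C \<subseteq> {x. c x \<noteq> 0} \<and> e \<in> C \<and> fam_circuit a C"
  using assms(2,3)
proof (induction "card {x. c x \<noteq> 0}" arbitrary: c rule: less_induct)
  case less
  let ?D = "{x. c x \<noteq> 0}"
  have DU: "?D \<subseteq> U" using less.prems(1) unfolding lin_dep_def by blast
  then have finD: "finite ?D" using assms(1) finite_subset by blast
  show ?case
  proof (cases "\<forall>C'. C' \<subset> ?D \<longrightarrow> indep_fam C' a")
    case True
    moreover have "\<not> indep_fam ?D a"
      using not_indep_fam_iff[OF assms(1) DU, of a] less.prems by blast
    ultimately show ?thesis
      using less.prems(2) unfolding fam_circuit_def by blast
  next
    case False
    then obtain C' where C': "C' \<subset> ?D" "\<not> indep_fam C' a" by blast
    then obtain b where b: "lin_dep a U b" "{x. b x \<noteq> 0} \<subseteq> C'" "{x. b x \<noteq> 0} \<noteq> {}"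
      using not_indep_fam_iff[OF assms(1), of C' a] DU by blast
    have "\<exists>c'. lin_dep a U c' \<and> c' e \<noteq> 0 \<and> {x. c' x \<noteq> 0} \<subset> ?D"
    proof (cases "b e = 0")
      case False
      then show ?thesis using b C' by blast
    next
      case True
      obtain y where y: "b y \<noteq> 0" using b(3) by blast
      \<comment> \<open>The multiple is chosen to cancel the coefficient at
        \<open>y\<close>.\<close>
      let ?c = "\<lambda>x. c x - c y / b y * b x"
      have "{x. ?c x \<noteq> 0} \<subseteq> ?D" "y \<notin> {x. ?c x \<noteq> 0}" "y \<in> ?D"
        using b(2) C'(1) y by auto
      then have "{x. ?c x \<noteq> 0} \<subset> ?D" by blast
      moreover have "?c e \<noteq> 0" using True less.prems(2) by simp
      ultimately show ?thesis
        using lin_dep_cancel[OF less.prems(1) b(1), of "c y / b y"] by blast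
    qed
    then obtain c' where c': "lin_dep a U c'" "c' e \<noteq> 0" "{x. c' x \<noteq> 0} \<subset> ?D" by blast
    then show ?thesis
      using less.hyps[OF psubset_card_mono[OF finD c'(3)] c'(1,2)] by blast
  qed
qed

text \<open>Strong circuit elimination: subtract dependencies so that \<open>f\<close> cancels; the
  coefficient at \<open>e\<close> survives because \<open>e\<close> lies outside
  \<open>C2\<close>.\<close>

lemma fam_circuit_elimination:
  assumes "finite C1" "finite C2" "fam_circuit a C1" "fam_circuit a C2"
    "f \<in> C1" "f \<in> C2" "e \<in> C1" "e \<notin> C2"
  shows "\<exists>C. C \<subseteq> C1 \<union> C2 - {f} \<and> e \<in> C \<and> fam_circuit a C"
proof -
  have U: "finite (C1 \<union> C2)" using assms by simp
  obtain c1 where c1: "lin_dep a (C1 \<union> C2) c1" "{x. c1 x \<noteq> 0} = C1"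
    using fam_circuit_lin_dep[OF U _ assms(3)] by blast
  obtain c2 where c2: "lin_dep a (C1 \<union> C2) c2" "{x. c2 x \<noteq> 0} = C2"
    using fam_circuit_lin_dep[OF U _ assms(4)] by blast
  let ?c = "\<lambda>x. c1 x - c1 f / c2 f * c2 x"
  have "c1 e \<noteq> 0" "c2 e = 0" "c2 f \<noteq> 0" using c1(2) c2(2) assms by auto
  then have "\<exists>C. C \<subseteq> {x. ?c x \<noteq> 0} \<and> e \<in> C \<and> fam_circuit a C"
    by (intro fam_circuit_through[OF U] lin_dep_cancel c1 c2) auto
  moreover have "{x. ?c x \<noteq> 0} \<subseteq> C1 \<union> C2 - {f}"
    using c1(2) c2(2) \<open>c2 f \<noteq> 0\<close> by auto
  ultimately show ?thesis by blast
qed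

text \<open>Minimal counterexample with respect to the size of the union. Eliminating a common
  element \<open>f\<close> yields circuits \<open>C3\<close> through \<open>e\<close> and
  \<open>C4\<close> through \<open>g\<close>. Minimality applied to \<open>C1\<close> and
  \<open>C4\<close> makes \<open>C3\<close> and \<open>C4\<close> meet; applied to these two, it
  contradicts that both avoid \<open>f\<close>.\<close>

lemma fam_circuit_trans:
  assumes "finite C1" "finite C2" "fam_circuit a C1" "fam_circuit a C2"
    "C1 \<inter> C2 \<noteq> {}" "e \<in> C1" "g \<in> C2"
  shows "\<exists>C. C \<subseteq> C1 \<union> C2 \<and> fam_circuit a C \<and> e \<in> C \<and> g \<in> C"
  using assms
proof (induction "card (C1 \<union> C2)" arbitrary: C1 C2 rule: less_induct)
  case less
  show ?case
  proof (rule ccontr)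
    assume no: "\<not> ?thesis"
    have e2: "e \<notin> C2" and g1: "g \<notin> C1" using no less.prems by blast+
    have fin: "finite (C1 \<union> C2)" using less.prems by simp
    obtain f where f: "f \<in> C1" "f \<in> C2" using less.prems by blast
    obtain C3 where C3: "C3 \<subseteq> C1 \<union> C2 - {f}" "e \<in> C3" "fam_circuit a C3"
      using fam_circuit_elimination[OF less.prems(1-4) f less.prems(6) e2] by blast
    obtain C4 where C4: "C4 \<subseteq> C2 \<union> C1 - {f}" "g \<in> C4" "fam_circuit a C4"
      using fam_circuit_elimination[OF less.prems(2,1,4,3) f(2,1) less.prems(7) g1] by blast
    have fin3: "finite C3" "finite C4" using C3 C4 fin finite_subset by blast+
    \<comment> \<open>A circuit has no proper subset that is a circuit, and \<open>C3\<close> and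
      \<open>C4\<close> both miss \<open>f\<close>.\<close>
    have n3: "\<not> C3 \<subseteq> C1" and n4: "\<not> C4 \<subseteq> C2"
      using C3 C4 f less.prems(3,4) unfolding fam_circuit_def by blast+
    have small: "A \<union> B = C1 \<union> C2" if "A \<union> B \<subseteq> C1 \<union> C2" "finite A" "finite B"
      "fam_circuit a A" "fam_circuit a B" "A \<inter> B \<noteq> {}" "e \<in> A" "g \<in> B" for A B
    proof (rule ccontr)
      assume "A \<union> B \<noteq> C1 \<union> C2"
      then have "card (A \<union> B) < card (C1 \<union> C2)"
        using that(1) fin by (intro psubset_card_mono) auto
      from less.hyps[OF this that(2-8)] that(1) no show False by blast
    qed
    have "C1 \<union> C4 = C1 \<union> C2"
      using C4 fin3 n4 less.prems by (intro small) auto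
    then have "C2 - C1 \<subseteq> C4" by blast
    then have "C3 \<inter> C4 \<noteq> {}" using n3 C3 by blast
    then have "C3 \<union> C4 = C1 \<union> C2"
      using C3 C4 fin3 by (intro small) auto
    then show False using C3 C4 f by blast
  qed
qed

section \<open>Generic realizations\<close>

definition rig_fam :: "nat \<Rightarrow> ('a \<Rightarrow> nat \<Rightarrow> real) \<Rightarrow> 'a set \<Rightarrow> 'a \<times> nat \<Rightarrow> real" where
  "rig_fam d p e x = rig_row d p e (fst x) (snd x)"

lemma rows_indep_iff: "rows_indep d p F \<longleftrightarrow> finite F \<and> indep_fam F (rig_fam d p)"
  by (simp add: rows_indep_def indep_fam_def rig_fam_def)

definition line :: "('a \<Rightarrow> nat \<Rightarrow> real) \<Rightarrow> ('a \<Rightarrow> nat \<Rightarrow> real) \<Rightarrow> real \<Rightarrow> 'a \<Rightarrow> nat \<Rightarrow> real" where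
  "line p q t v i = p v i + t * (q v i - p v i)"

lemma rig_fam_line:
  "rig_fam d (line p q t) e x = rig_fam d p e x + t * (rig_fam d q e x - rig_fam d p e x)"
proof -
  have "(\<Sum>y\<in>e. line p q t w i - line p q t y i) =
      (\<Sum>y\<in>e. p w i - p y i) + t * ((\<Sum>y\<in>e. q w i - q y i) - (\<Sum>y\<in>e. p w i - p y i))" for w i
    unfolding sum_subtractf[symmetric] sum_distrib_left sum.distrib[symmetric]
    by (rule sum.cong) (auto simp: line_def algebra_simps)
  then show ?thesis by (simp add: rig_fam_def rig_row_def)
qed

text \<open>Phrased for any matrix \<open>A\<close> that is affine along the line, since it serves
  both \<open>rig_fam\<close> and \<open>equilibrium\<close>. The two endpoints are the parameters 0
  and 1.\<close>

lemma finite_dependent_on_line: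
  assumes aff: "\<And>t i j. A (line p q t) i j = A p i j + t * (A q i j - A p i j)"
    and "finite I" and ind: "indep_fam I (A p) \<or> indep_fam I (A q)"
  shows "finite {t. \<not> indep_fam I (A (line p q t))}"
proof -
  define P where "P i j = [:A p i j, A q i j - A p i j:]" for i j
  have eq: "A (line p q t) = (\<lambda>i j. poly (P i j) t)" for t
    by (intro ext) (simp add: aff P_def)
  have "A p = (\<lambda>i j. poly (P i j) 0)" "A q = (\<lambda>i j. poly (P i j) 1)"
    by (auto intro!: ext simp: P_def)
  with ind obtain t0 where "indep_fam I (\<lambda>i j. poly (P i j) t0)" by metis
  from finite_dependent_parameters[OF assms(2) this] show ?thesis by (simp add: eq)
qed

text \<open>Join a realization good for \<open>S\<close> to one good for \<open>F0\<close> by a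
  line. Each independent set excludes only finitely many parameters, so some point of the line is
  good for all of them.\<close>

lemma simultaneously_independent:
  assumes "finite S"
  shows "\<exists>p. \<forall>F\<in>S. R_indep d F \<longrightarrow> rows_indep d p F"
  using assms
proof (induction S rule: finite_induct)
  case empty
  then show ?case by simp
next
  case (insert F0 S)
  then obtain p where p: "\<And>F. F \<in> S \<Longrightarrow> R_indep d F \<Longrightarrow> rows_indep d p F" by blast
  show ?case
  proof (cases "R_indep d F0")
    case False
    then show ?thesis using p by blast
  next
    case True
    then obtain q where q: "rows_indep d q F0" unfolding R_indep_def by blast
    define bad where "bad F = {t. \<not> indep_fam F (rig_fam d (line p q t))}" for F
    have fin: "finite (bad F)" if "F \<in> insert F0 S" "R_indep d F" for F
      unfolding bad_def
      using that p q by (intro finite_dependent_on_line rig_fam_line) (auto simp: rows_indep_iff)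
    have "finite (\<Union>F\<in>{F\<in>insert F0 S. R_indep d F}. bad F)"
      using insert.hyps fin by auto
    then obtain t where t: "t \<notin> (\<Union>F\<in>{F\<in>insert F0 S. R_indep d F}. bad F)"
      using ex_new_if_finite infinite_UNIV_char_0 by blast
    have "rows_indep d (line p q t) F" if "F \<in> insert F0 S" "R_indep d F" for F
      using t that by (auto simp: bad_def rows_indep_iff R_indep_def)
    then show ?thesis by blast
  qed
qed

text \<open>Over a fixed finite ground set, existential independence becomes that of a single
  matrix, which makes the circuit results for linear families applicable.\<close>

lemma generic_realization:
  assumes "finite E"
  obtains p where "\<And>F. F \<subseteq> E \<Longrightarrow> R_indep d F \<longleftrightarrow> indep_fam F (rig_fam d p)"
proof -
  obtain p where p: "\<forall>F\<in>Pow E. R_indep d F \<longrightarrow> rows_indep d p F"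
    using simultaneously_independent[of "Pow E" d] assms by auto
  have "R_indep d F \<longleftrightarrow> indep_fam F (rig_fam d p)" if "F \<subseteq> E" for F
    using p that finite_subset[OF that assms] unfolding R_indep_def rows_indep_iff by blast
  with that show thesis by blast
qed

section \<open>The rigidity matroid\<close>

lemma R_indep_finite: "R_indep d F \<Longrightarrow> finite F"
  unfolding R_indep_def rows_indep_def by blast

lemma R_indep_empty: "R_indep d {}"
  by (simp add: R_indep_def rows_indep_def)

lemma R_indep_subset:
  assumes "R_indep d F" "D \<subseteq> F"
  shows "R_indep d D"
proof -
  obtain p where "finite F" "indep_fam F (rig_fam d p)"
    using assms(1) unfolding R_indep_def rows_indep_iff by blast
  then have "finite D \<and> indep_fam D (rig_fam d p)"
    using assms(2) by (simp add: indep_fam_subset finite_subset)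
  then show ?thesis unfolding R_indep_def rows_indep_iff by blast
qed

lemma dependent_contains_circuit:
  assumes "finite F" "\<not> R_indep d F"
  shows "\<exists>C\<subseteq>F. R_circuit d C"
  using assms
proof (induction F rule: finite_psubset_induct)
  case (psubset F)
  show ?case
  proof (cases "R_circuit d F")
    case False
    then obtain C' where C': "C' \<subset> F" "\<not> R_indep d C'"
      using psubset.prems unfolding R_circuit_def by blast
    from psubset.IH[OF C'] show ?thesis using C'(1) by (meson psubset_imp_subset subset_trans)
  qed blast
qed

text \<open>Only transitivity has content; it is \<open>fam_circuit_trans\<close> at a generic
  realization.\<close>

lemma equiv_M_rel:
  assumes "finite E"
  shows "equiv E (M_rel d E)"
proof -
  obtain p where p: "\<And>F. F \<subseteq> E \<Longrightarrow> R_indep d F \<longleftrightarrow> indep_fam F (rig_fam d p)"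
    using generic_realization[OF assms] by blast
  have circ: "R_circuit d C \<longleftrightarrow> fam_circuit (rig_fam d p) C" if "C \<subseteq> E" for C
  proof -
    have "R_indep d C' \<longleftrightarrow> indep_fam C' (rig_fam d p)" if "C' \<subset> C" for C'
      using p that \<open>C \<subseteq> E\<close> by blast
    with p[OF that] show ?thesis unfolding R_circuit_def fam_circuit_def by blast
  qed
  have "trans (M_rel d E)"
  proof (rule transI)
    fix e f g
    assume ef: "(e, f) \<in> M_rel d E" and fg: "(f, g) \<in> M_rel d E"
    show "(e, g) \<in> M_rel d E"
    proof (cases "e = f \<or> f = g")
      case True
      then show ?thesis using ef fg by blast
    next
      case False
      then obtain C1 C2 where C: "C1 \<subseteq> E" "R_circuit d C1" "e \<in> C1" "f \<in> C1"
        "C2 \<subseteq> E" "R_circuit d C2" "f \<in> C2" "g \<in> C2"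
        using ef fg unfolding M_rel_def by blast
      then have "\<exists>C. C \<subseteq> C1 \<union> C2 \<and> fam_circuit (rig_fam d p) C \<and> e \<in> C \<and> g \<in> C"
        using circ finite_subset[OF _ assms] by (intro fam_circuit_trans) auto
      then obtain C3 where "C3 \<subseteq> C1 \<union> C2" "fam_circuit (rig_fam d p) C3" "e \<in> C3" "g \<in> C3"
        by blast
      then have "C3 \<subseteq> E \<and> R_circuit d C3 \<and> e \<in> C3 \<and> g \<in> C3" using circ C by blast
      then show ?thesis unfolding M_rel_def by blast
    qed
  qed
  moreover have "refl_on E (M_rel d E)" "sym (M_rel d E)" "M_rel d E \<subseteq> E \<times> E"
    by (auto simp: refl_on_def sym_def M_rel_def)
  ultimately show ?thesis by (simp add: equiv_def)
qed

section \<open>Rank, bases and circuits of the rigidity matroid\<close>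

lemma rank_d_ge:
  assumes "finite F" "D \<subseteq> F" "R_indep d D"
  shows "card D \<le> rank_d d F"
proof -
  have "finite {card F' |F'. F' \<subseteq> F \<and> R_indep d F'}"
    by (rule finite_subset[of _ "card ` Pow F"]) (use assms in auto)
  then show ?thesis unfolding rank_d_def by (rule Max_ge) (use assms in blast)
qed

lemma rank_d_attained:
  assumes "finite F"
  obtains B where "B \<subseteq> F" "R_indep d B" "card B = rank_d d F"
proof -
  let ?S = "{card F' |F'. F' \<subseteq> F \<and> R_indep d F'}"
  have "finite ?S"
    by (rule finite_subset[of _ "card ` Pow F"]) (use assms in auto)
  moreover have "?S \<noteq> {}" using R_indep_empty by blast
  ultimately have "rank_d d F \<in> ?S" unfolding rank_d_def by (rule Max_in)
  with that show thesis by auto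
qed

lemma circuit_in_component:
  assumes "finite E" "K \<in> M_components d E" "C \<subseteq> E" "R_circuit d C" "C \<inter> K \<noteq> {}"
  shows "C \<subseteq> K"
proof
  fix f assume f: "f \<in> C"
  obtain e where e: "e \<in> C" "e \<in> K" using assms by blast
  then have "(e, f) \<in> M_rel d E" using f assms(3,4) unfolding M_rel_def by blast
  moreover have "K \<in> E // M_rel d E" using assms(2) unfolding M_components_def .
  ultimately show "f \<in> K"
    using e(2) in_quotient_imp_closed[OF equiv_M_rel[OF assms(1)]] by metis
qed

lemma M_components_props:
  assumes "finite E"
  shows "finite (M_components d E)" and "\<Union>(M_components d E) = E"
    and "pairwise disjnt (M_components d E)"
proof -
  note eq = equiv_M_rel[OF assms, of d]
  show U: "\<Union>(M_components d E) = E"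
    unfolding M_components_def by (rule Union_quotient[OF eq])
  show "finite (M_components d E)"
    using assms U finite_UnionD by metis
  show "pairwise disjnt (M_components d E)"
    unfolding pairwise_def disjnt_def M_components_def using quotient_disj[OF eq] by blast
qed

text \<open>Choose a basis of each component. A circuit in their union would lie in one component,
  hence inside one of the chosen bases.\<close>

lemma sum_rank_components_le:
  assumes "finite E"
  shows "(\<Sum>K\<in>M_components d E. rank_d d K) \<le> rank_d d E"
proof -
  note props = M_components_props[OF assms, of d]
  have finK: "finite K" if "K \<in> M_components d E" for K
    using that props(2) assms by (metis Union_upper finite_subset)
  have "\<exists>B. B \<subseteq> K \<and> R_indep d B \<and> card B = rank_d d K" if "K \<in> M_components d E" for K
    using rank_d_attained[OF finK[OF that]] by metis
  then obtain B where B: "\<And>K. K \<in> M_components d E \<Longrightarrow>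
      B K \<subseteq> K \<and> R_indep d (B K) \<and> card (B K) = rank_d d K"
    by metis
  let ?U = "\<Union>K\<in>M_components d E. B K"
  have UE: "?U \<subseteq> E" using B props(2) by blast
  have disj: "K = L" if "K \<in> M_components d E" "L \<in> M_components d E" "x \<in> K" "x \<in> L" for K L x
    using props(3) that unfolding pairwise_def disjnt_def by blast
  have "R_indep d ?U"
  proof (rule ccontr)
    assume "\<not> R_indep d ?U"
    then obtain C where C: "C \<subseteq> ?U" "R_circuit d C"
      using dependent_contains_circuit[OF finite_subset[OF UE assms]] by blast
    then have "C \<noteq> {}" using R_indep_empty unfolding R_circuit_def by blast
    then obtain x K where x: "x \<in> C" "K \<in> M_components d E" "x \<in> B K" using C by blast
    have "C \<subseteq> E" "C \<inter> K \<noteq> {}" using C UE x B[OF x(2)] by blast+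
    then have "C \<subseteq> K" using circuit_in_component[OF assms x(2) _ C(2)] by blast
    have "C \<subseteq> B K"
    proof
      fix y assume "y \<in> C"
      then obtain L where "L \<in> M_components d E" "y \<in> B L" using C by blast
      moreover from this have "L = K" using disj[of L K y] B x(2) \<open>y \<in> C\<close> \<open>C \<subseteq> K\<close> by blast
      ultimately show "y \<in> B K" by simp
    qed
    then show False using B x(2) R_indep_subset C(2) unfolding R_circuit_def by metis
  qed
  then have "card ?U \<le> rank_d d E" using rank_d_ge[OF assms UE] by blast
  moreover have "card ?U = (\<Sum>K\<in>M_components d E. card (B K))"
  proof (rule card_UN_disjoint)
    show "\<forall>i\<in>M_components d E. finite (B i)" using B R_indep_finite by blast
    show "\<forall>i\<in>M_components d E. \<forall>j\<in>M_components d E. i \<noteq> j \<longrightarrow> B i \<inter> B j = {}"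
      using B disj by blast
  qed (rule props(1))
  ultimately show ?thesis using B by simp
qed

text \<open>A basis avoiding \<open>e\<close> of full rank becomes dependent when \<open>e\<close>
  is added, and the resulting circuit must use \<open>e\<close>.\<close>

lemma non_coloop_in_circuit:
  assumes "finite E" "e \<in> E" "rank_d d (E - {e}) = rank_d d E"
  shows "\<exists>C\<subseteq>E. R_circuit d C \<and> e \<in> C"
proof -
  obtain B where B: "B \<subseteq> E - {e}" "R_indep d B" "card B = rank_d d E"
    using rank_d_attained[of "E - {e}" d] assms by auto
  have finB: "finite B" using B(2) R_indep_finite by blast
  then have "card (insert e B) > rank_d d E" using B by (subst card_insert_disjoint) auto
  then have "\<not> R_indep d (insert e B)"
    using rank_d_ge[OF assms(1), of "insert e B" d] B(1) assms(2) by auto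
  then obtain C where C: "C \<subseteq> insert e B" "R_circuit d C"
    using dependent_contains_circuit[of "insert e B" d] finB by blast
  then have "e \<in> C" using B(2) R_indep_subset unfolding R_circuit_def by (metis subset_insert)
  then show ?thesis using C B(1) assms(2) by blast
qed

text \<open>The vertices are placed at corners of a simplex. The lemma forces every circuit to span
  at least \<open>d + 2\<close> vertices.\<close>

lemma R_indep_few_vertices:
  assumes "finite F" "\<And>e. e \<in> F \<Longrightarrow> card e = 2" "card (\<Union>F) \<le> d + 1"
  shows "R_indep d F"
proof -
  have "finite (\<Union>F)" using assms by (metis card.infinite finite_Union zero_neq_numeral)
  then obtain h :: "'a \<Rightarrow> nat" where h: "h ` (\<Union>F) \<subseteq> {..d}" "inj_on h (\<Union>F)"
    using card_le_inj[of "\<Union>F" "{..d}"] assms(3) by auto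
  \<comment> \<open>Label \<open>k < d\<close> means the \<open>k\<close>-th unit vector. Label
    \<open>d\<close> is effectively the origin, as \<open>rig_row\<close> ignores coordinate
    \<open>d\<close>.\<close>
  define p :: "'a \<Rightarrow> nat \<Rightarrow> real" where "p v k = of_bool (h v = k)" for v k
  have main: "c {u, v} = 0"
    if c: "\<And>x. (\<Sum>e\<in>F. c e * rig_fam d p e x) = 0" and uv: "{u, v} \<in> F" "u \<noteq> v" "h u < d" for c u v
  proof -
    have huv: "h v \<noteq> h u" using h(2) uv unfolding inj_on_def by blast
    \<comment> \<open>Among the edges at \<open>v\<close>, only the one to \<open>u\<close> has
      endpoints that differ in coordinate \<open>h u\<close>, so this column isolates a single
      edge.\<close>
    have row: "rig_fam d p e (v, h u) = (if e = {u, v} then - 1 else 0)" if e: "e \<in> F" for e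
    proof (cases "v \<in> e")
      case True
      obtain x where x: "e = {v, x}" "x \<noteq> v"
        using assms(2)[OF e] True by (auto simp: card_2_iff)
      have "h x = h u \<longleftrightarrow> x = u" using h(2) uv e x unfolding inj_on_def by blast
      then show ?thesis
        using x uv huv by (auto simp: rig_fam_def rig_row_def p_def doubleton_eq_iff)
    next
      case False
      then show ?thesis by (auto simp: rig_fam_def rig_row_def)
    qed
    have "0 = (\<Sum>e\<in>F. c e * rig_fam d p e (v, h u))" using c by simp
    also have "\<dots> = (\<Sum>e\<in>F. if e = {u, v} then - c {u, v} else 0)"
      by (intro sum.cong) (auto simp: row)
    also have "\<dots> = - c {u, v}" using assms(1) uv by simp
    finally show ?thesis by simp
  qed
  have "indep_fam F (rig_fam d p)"
    unfolding indep_fam_def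
  proof (intro allI impI ballI)
    fix c e assume c: "\<forall>x. (\<Sum>e\<in>F. c e * rig_fam d p e x) = 0" and e: "e \<in> F"
    obtain u v where uv: "e = {u, v}" "u \<noteq> v" using assms(2)[OF e] by (auto simp: card_2_iff)
    have "h u \<noteq> h v" using h(2) uv e unfolding inj_on_def by blast
    moreover have "h u \<le> d" "h v \<le> d" using h(1) uv e by auto
    ultimately have "h u < d \<or> h v < d" by linarith
    then show "c e = 0"
      using main[of c u v] main[of c v u] c uv e by (auto simp: insert_commute)
  qed
  then show ?thesis using assms(1) unfolding R_indep_def rows_indep_iff by blast
qed

section \<open>The Maxwell bound\<close>

text \<open>Column indices \<^term>\<open>(None, k)\<close> express the equilibrium of forces in direction \<open>k\<close>, and
  \<^term>\<open>(Some l, k)\<close> the vanishing of the torque in the \<open>(k, l)\<close>-plane.\<close>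

definition equilibrium :: "nat \<Rightarrow> ('a \<Rightarrow> nat \<Rightarrow> real) \<Rightarrow> 'a \<times> nat \<Rightarrow> nat option \<times> nat \<Rightarrow> real" where
  "equilibrium d p x y = (case y of
      (None, k) \<Rightarrow> of_bool (snd x = k)
    | (Some l, k) \<Rightarrow> if k < d \<and> l < d
        then of_bool (snd x = k) * p (fst x) l - of_bool (snd x = l) * p (fst x) k else 0)"

lemma equilibrium_line:
  "equilibrium d (line p q t) x y =
    equilibrium d p x y + t * (equilibrium d q x y - equilibrium d p x y)"
  by (cases y) (auto simp: equilibrium_def line_def algebra_simps split: option.split)

text \<open>An edge row is a pair of opposite forces along the line through its endpoints, so net
  force and torque vanish.\<close>

lemma rig_fam_equilibrium:
  assumes "finite V" "e \<subseteq> V" "card e = 2"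
  shows "(\<Sum>x\<in>V \<times> {..<d}. rig_fam d p e x * equilibrium d p x y) = 0"
proof -
  obtain u v where e: "e = {u, v}" "u \<noteq> v" using assms(3) by (auto simp: card_2_iff)
  obtain l k where y: "y = (l, k)" by (cases y)
  have "(\<Sum>x\<in>V \<times> {..<d}. rig_fam d p e x * equilibrium d p x y)
      = (\<Sum>x\<in>e \<times> {..<d}. rig_fam d p e x * equilibrium d p x y)"
    using assms by (intro sum.mono_neutral_right) (auto simp: rig_fam_def rig_row_def)
  also have "\<dots> = (\<Sum>w\<in>e. \<Sum>i<d. rig_fam d p e (w, i) * equilibrium d p (w, i) y)"
    by (simp add: sum.cartesian_product)
  also have "\<dots> = (\<Sum>i<d. (p u i - p v i) * (equilibrium d p (u, i) y - equilibrium d p (v, i) y))"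
    using e by (simp add: rig_fam_def rig_row_def sum.distrib[symmetric] algebra_simps)
  also have "\<dots> = 0"
  proof (cases l)
    case None
    then show ?thesis by (simp add: y equilibrium_def)
  next
    case (Some l')
    show ?thesis
    proof (cases "k < d \<and> l' < d")
      case True
      \<comment> \<open>The two surviving terms are the same product of coordinate differences with
        opposite signs.\<close>
      then have "(\<Sum>i<d. (p u i - p v i) * (equilibrium d p (u, i) y - equilibrium d p (v, i) y)) =
          (\<Sum>i<d. (if i = k then (p u k - p v k) * (p u l' - p v l') else 0)
            - (if i = l' then (p u l' - p v l') * (p u k - p v k) else 0))"
        by (intro sum.cong) (auto simp: y Some equilibrium_def algebra_simps)
      then show ?thesis using True by (simp add: sum_subtractf)
    qed (auto simp: y Some equilibrium_def)
  qed
  finally show ?thesis .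
qed

text \<open>Pinning the coordinates \<open>i \<ge> j\<close> of the \<open>j\<close>-th of \<open>d\<close> vertices leaves no nonzero
  system of reaction forces in equilibrium. The pair \<open>(i, j)\<close> stands for this pinned coordinate;
  the realization used puts \<open>w 0\<close> at the origin and \<open>w j\<close> at the unit vector \<open>j - 1\<close>.\<close>

lemma pins_independent:
  assumes "inj_on w {..<d}"
  shows "\<exists>p. indep_fam (SIGMA i:{..<d}. {..i}) (\<lambda>(i, j). equilibrium d p (w j, i))"
proof -
  let ?P = "SIGMA i:{..<d}. {..i}"
  define p :: "'a \<Rightarrow> nat \<Rightarrow> real" where "p v k = of_bool (\<exists>j<d. w j = v \<and> j = Suc k)" for v k
  have p: "p (w j) k = of_bool (j = Suc k)" if "j < d" for j k
    using assms that unfolding p_def inj_on_def by auto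
  have "indep_fam ?P (\<lambda>(i, j). equilibrium d p (w j, i))"
    unfolding indep_fam_def
  proof (intro allI impI)
    fix f :: "nat \<times> nat \<Rightarrow> real"
    assume f: "\<forall>y. (\<Sum>x\<in>?P. f x * (case x of (i, j) \<Rightarrow> equilibrium d p (w j, i)) y) = 0"
    \<comment> \<open>In the torque column \<open>(Some l, k)\<close> only the pin
      \<open>(l, Suc k)\<close> contributes: the other candidate, \<open>(k, Suc l)\<close>,
      violates \<open>j \<le> i\<close> because \<open>k < l\<close>.\<close>
    have pos: "f (l, Suc k) = 0" if "k < l" "l < d" for k l
    proof -
      have "0 = (\<Sum>x\<in>?P. f x * (case x of (i, j) \<Rightarrow> equilibrium d p (w j, i)) (Some l, k))"
        using f by simp
      also have "\<dots> = (\<Sum>x\<in>?P. if x = (l, Suc k) then - f (l, Suc k) else 0)"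
        using that by (intro sum.cong) (auto simp: equilibrium_def p of_bool_def split: if_splits)
      also have "\<dots> = - f (l, Suc k)" using that by (subst sum.delta) auto
      finally show ?thesis by simp
    qed
    \<comment> \<open>With the pins of positive \<open>j\<close> gone, force balance in direction
      \<open>k\<close> leaves only the pin \<open>(k, 0)\<close>.\<close>
    have zero: "f (k, 0) = 0" if "k < d" for k
    proof -
      have "0 = (\<Sum>x\<in>?P. f x * (case x of (i, j) \<Rightarrow> equilibrium d p (w j, i)) (None, k))"
        using f by simp
      also have "\<dots> = (\<Sum>x\<in>?P. if x = (k, 0) then f (k, 0) else 0)"
      proof (intro sum.cong refl)
        fix x assume x: "x \<in> ?P"
        then obtain i j where ij: "x = (i, j)" "i < d" "j \<le> i" by auto
        then have "j = 0 \<or> f x = 0" using pos[of "j - 1" i] by (cases j) auto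
        then show "f x * (case x of (i, j) \<Rightarrow> equilibrium d p (w j, i)) (None, k)
            = (if x = (k, 0) then f (k, 0) else 0)"
          using ij by (auto simp: equilibrium_def)
      qed
      also have "\<dots> = f (k, 0)" using that by (subst sum.delta) auto
      finally show ?thesis by simp
    qed
    show "\<forall>x\<in>?P. f x = 0"
    proof
      fix x assume "x \<in> ?P"
      then obtain i j where ij: "x = (i, j)" "i < d" "j \<le> i" by auto
      then show "f x = 0" using pos[of "j - 1" i] zero[of i] by (cases j) auto
    qed
  qed
  then show ?thesis by blast
qed

lemma card_pins: "card (SIGMA i:{..<d}. {..i}) = (d + 1) choose 2"
proof -
  have "(\<Sum>i<d. Suc i) = (d + 1) choose 2"
    by (induction d) (simp_all add: numeral_2_eq_2)
  then show ?thesis by simp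
qed

text \<open>Deleting the pinned columns keeps the rows independent: a dependency of the truncated
  rows gives a load carried by the pins alone and in equilibrium, hence zero. Counting the remaining
  columns gives the bound.\<close>

theorem maxwell_bound:
  assumes "finite V" "d \<le> card V" "R_indep d F" "\<And>e. e \<in> F \<Longrightarrow> e \<subseteq> V \<and> card e = 2"
  shows "card F + ((d + 1) choose 2) \<le> d * card V"
proof -
  let ?P = "SIGMA i:{..<d}. {..i}"
  let ?T = "\<lambda>p w (i, j). equilibrium d p (w j, i)"
  have finF: "finite F" using assms(3) R_indep_finite by blast
  obtain w where w: "w ` {..<d} \<subseteq> V" "inj_on w {..<d}"
    using card_le_inj[of "{..<d}" V] assms(1,2) by auto
  obtain q where q: "indep_fam ?P (?T q w)" using pins_independent[OF w(2)] by blast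
  obtain p0 where p0: "indep_fam F (rig_fam d p0)"
    using assms(3) unfolding R_indep_def rows_indep_iff by blast
  \<comment> \<open>Rows and pins may be independent at different realizations; a point of the
    joining line serves both.\<close>
  have "finite {t. \<not> indep_fam F (rig_fam d (line p0 q t))}"
    using finF p0 by (intro finite_dependent_on_line rig_fam_line) auto
  moreover have "finite {t. \<not> indep_fam ?P (?T (line p0 q t) w)}"
    using q by (intro finite_dependent_on_line[where A = "\<lambda>p. ?T p w"])
      (auto simp: equilibrium_line split: prod.split)
  ultimately obtain t where t: "indep_fam F (rig_fam d (line p0 q t))"
      "indep_fam ?P (?T (line p0 q t) w)"
    using ex_new_if_finite[OF infinite_UNIV_char_0 finite_UnI] by blast
  define p where "p = line p0 q t"
  define pin where "pin = (\<lambda>(i, j). (w j, i :: nat))"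
  have inj: "inj_on pin ?P" using w(2) unfolding pin_def inj_on_def by auto
  have pins: "pin ` ?P \<subseteq> V \<times> {..<d}" using w(1) unfolding pin_def by auto
  let ?J = "V \<times> {..<d} - pin ` ?P"
  have "indep_fam F (\<lambda>e x. if x \<in> ?J then rig_fam d p e x else 0)"
    unfolding indep_fam_def
  proof (intro allI impI)
    fix c
    assume c: "\<forall>x. (\<Sum>e\<in>F. c e * (if x \<in> ?J then rig_fam d p e x else 0)) = 0"
    \<comment> \<open>The resulting load: it vanishes off the pins, and equilibrium then kills it on
      the pins.\<close>
    define f where "f x = (\<Sum>e\<in>F. c e * rig_fam d p e x)" for x
    have f0: "f x = 0" if "x \<notin> pin ` ?P" for x
    proof (cases "x \<in> ?J")
      case True
      then show ?thesis using c[rule_format, of x] by (simp add: f_def)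
    next
      case False
      then have "rig_fam d p e x = 0" if "e \<in> F" for e
        using \<open>x \<notin> pin ` ?P\<close> assms(4)[OF that]
        by (cases x) (auto simp: rig_fam_def rig_row_def)
      then show ?thesis by (simp add: f_def)
    qed
    have "(\<Sum>x\<in>?P. f (pin x) * ?T p w x y) = 0" for y
    proof -
      have "(\<Sum>x\<in>?P. f (pin x) * ?T p w x y) = (\<Sum>x\<in>pin ` ?P. f x * equilibrium d p x y)"
        by (subst sum.reindex[OF inj]) (auto simp: pin_def intro!: sum.cong)
      also have "\<dots> = (\<Sum>x\<in>V \<times> {..<d}. f x * equilibrium d p x y)"
        using pins f0 assms(1) by (intro sum.mono_neutral_left) auto
      also have "\<dots> = (\<Sum>x\<in>V \<times> {..<d}. \<Sum>e\<in>F. c e * (rig_fam d p e x * equilibrium d p x y))"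
        by (simp add: f_def sum_distrib_right mult.assoc)
      also have "\<dots> = (\<Sum>e\<in>F. c e * (\<Sum>x\<in>V \<times> {..<d}. rig_fam d p e x * equilibrium d p x y))"
        by (subst sum.swap) (simp add: sum_distrib_left)
      also have "\<dots> = 0"
        using assms(4) rig_fam_equilibrium[OF assms(1)] by (intro sum.neutral) auto
      finally show ?thesis .
    qed
    then have f1: "f (pin x) = 0" if "x \<in> ?P" for x
      using indep_famD[OF t(2), of "\<lambda>x. f (pin x)" x] that by (simp add: p_def)
    have "f x = 0" for x
    proof (cases "x \<in> pin ` ?P")
      case True
      then show ?thesis using f1 by (elim imageE) simp
    qed (rule f0)
    then show "\<forall>e\<in>F. c e = 0"
      using indep_famD[OF t(1), of c] unfolding f_def p_def by blast
  qed
  then have "card F \<le> card ?J"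
    using finF assms(1)
    by (intro indep_fam_card_le[where a = "\<lambda>e x. if x \<in> ?J then rig_fam d p e x else 0"]) auto
  moreover have "card ?J = card (V \<times> {..<d}) - card (pin ` ?P)"
    using pins finite_subset[OF pins] assms(1) by (intro card_Diff_subset) auto
  moreover have "card (pin ` ?P) \<le> card (V \<times> {..<d})"
    using pins assms(1) by (intro card_mono) auto
  moreover have "card (pin ` ?P) = (d + 1) choose 2"
    using card_image[OF inj] card_pins by simp
  moreover have "card (V \<times> {..<d}) = d * card V" by (simp add: card_cartesian_product)
  ultimately show ?thesis by linarith
qed

section \<open>Counting shared vertices\<close>

lemma double_count:
  assumes "finite V" "finite M"
  shows "(\<Sum>K\<in>M. card {v\<in>V. R K v}) = (\<Sum>v\<in>V. card {K\<in>M. R K v})"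
proof -
  have "(\<Sum>K\<in>M. card {v\<in>V. R K v}) = (\<Sum>K\<in>M. \<Sum>v\<in>V. if R K v then 1 else 0)"
    using assms by (simp add: sum.If_cases Int_def)
  also have "\<dots> = (\<Sum>v\<in>V. \<Sum>K\<in>M. if R K v then 1 else 0)" by (rule sum.swap)
  also have "\<dots> = (\<Sum>v\<in>V. card {K\<in>M. R K v})"
    using assms by (simp add: sum.If_cases Int_def)
  finally show ?thesis .
qed

text \<open>Compare vertex by vertex: if \<open>v\<close> lies in \<open>s v\<close> of the sets, it
  counts as shared in \<open>s v\<close> of them when \<open>s v \<ge> 2\<close> and in none when
  \<open>s v = 1\<close>, hence in at most \<open>2 * s v - 2\<close>.\<close>

lemma sum_card_components_ge:
  assumes "finite V" "finite M" "\<And>K. K \<in> M \<Longrightarrow> U K \<subseteq> V" "V \<subseteq> (\<Union>K\<in>M. U K)"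
    and shared: "\<And>K. K \<in> M \<Longrightarrow> n \<le> card {v \<in> U K. \<exists>L\<in>M. L \<noteq> K \<and> v \<in> U L}"
  shows "2 * card V + card M * n \<le> 2 * (\<Sum>K\<in>M. card (U K))"
proof -
  define s where "s v = card {K\<in>M. v \<in> U K}" for v
  define R where "R K v \<longleftrightarrow> v \<in> U K \<and> (\<exists>L\<in>M. L \<noteq> K \<and> v \<in> U L)" for K v
  have "(\<Sum>K\<in>M. card (U K)) = (\<Sum>K\<in>M. card {v\<in>V. v \<in> U K})"
    using assms(3) by (intro sum.cong refl arg_cong[where f = card]) auto
  then have total: "(\<Sum>K\<in>M. card (U K)) = (\<Sum>v\<in>V. s v)"
    using double_count[OF assms(1,2), of "\<lambda>K v. v \<in> U K"] by (simp add: s_def)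
  have "card M * n = (\<Sum>K\<in>M. n)" by simp
  also have "\<dots> \<le> (\<Sum>K\<in>M. card {v\<in>V. R K v})"
  proof (rule sum_mono)
    fix K assume K: "K \<in> M"
    have "{v \<in> U K. \<exists>L\<in>M. L \<noteq> K \<and> v \<in> U L} = {v\<in>V. R K v}"
      using assms(3)[OF K] by (auto simp: R_def)
    then show "n \<le> card {v\<in>V. R K v}" using shared[OF K] by simp
  qed
  also have "\<dots> = (\<Sum>v\<in>V. card {K\<in>M. R K v})" by (rule double_count[OF assms(1,2)])
  finally have "2 * card V + card M * n \<le> (\<Sum>v\<in>V. card {K\<in>M. R K v} + 2)"
    by (simp only: sum.distrib) simp
  also have "\<dots> \<le> (\<Sum>v\<in>V. 2 * s v)"
  proof (rule sum_mono)
    fix v assume v: "v \<in> V"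
    have fin: "finite {K\<in>M. v \<in> U K}" using assms(2) by simp
    obtain K where K: "K \<in> M" "v \<in> U K" using v assms(4) by blast
    show "card {K\<in>M. R K v} + 2 \<le> 2 * s v"
    proof (cases "\<exists>L\<in>M. L \<noteq> K \<and> v \<in> U L")
      case True
      then obtain L where L: "L \<in> M" "L \<noteq> K" "v \<in> U L" by blast
      have "card {K, L} \<le> s v"
        unfolding s_def using K L fin by (intro card_mono) auto
      moreover have "card {K\<in>M. R K v} \<le> s v"
        unfolding s_def using fin by (intro card_mono) (auto simp: R_def)
      ultimately show ?thesis using L by simp
    next
      case False
      then have only: "L = K" if "L \<in> M" "v \<in> U L" for L using that by blast
      then have "{K\<in>M. v \<in> U K} = {K}" using K by blast
      moreover have "\<not> R L v" if "L \<in> M" for L using only that unfolding R_def by metis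
      then have "card {K\<in>M. R K v} = 0" by (simp add: Collect_empty_eq[THEN iffD2])
      ultimately show ?thesis by (simp add: s_def)
    qed
  qed
  finally show ?thesis by (simp add: total sum_distrib_left)
qed

lemma connected_vertex_in_edge:
  assumes "graph_connected V E" "u \<in> V" "v \<in> V" "u \<noteq> v"
  shows "u \<in> \<Union>E"
proof -
  have "(u, v) \<in> (adj_in V E)\<^sup>*" using assms unfolding graph_connected_def by blast
  then obtain x where "(u, x) \<in> adj_in V E" using assms(4) by (meson converse_rtranclE)
  then show ?thesis unfolding adj_in_def by auto
qed

text \<open>With at most \<open>d\<close> shared vertices, deleting them would keep the graph
  connected. Yet \<open>K\<close> and \<open>L\<close> both retain a vertex, and a walk starting in
  \<open>K\<close> can leave \<open>K\<close> only through a shared vertex.\<close>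

lemma shared_vertices_ge:
  assumes simple: "simple_graph V E" and conn: "k_connected (d + 1) V E"
    and cover: "\<Union>M = E" and big: "\<And>K. K \<in> M \<Longrightarrow> d + 2 \<le> card (\<Union>K)"
    and K: "K \<in> M" and L: "L \<in> M" "L \<noteq> K"
  shows "d + 1 \<le> card {v \<in> \<Union>K. \<exists>L\<in>M. L \<noteq> K \<and> v \<in> \<Union>L}"
proof (rule ccontr)
  let ?X = "{v \<in> \<Union>K. \<exists>L\<in>M. L \<noteq> K \<and> v \<in> \<Union>L}"
  assume "\<not> ?thesis"
  then have small: "card ?X < d + 1" by simp
  have finV: "finite V" and EV: "\<Union>E \<subseteq> V" using simple unfolding simple_graph_def by auto
  have sub: "\<Union>N \<subseteq> V" if "N \<in> M" for N using cover that EV by blast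
  have XV: "?X \<subseteq> V" using sub[OF K] by blast
  then have finX: "finite ?X" using finV finite_subset by blast
  have con: "graph_connected (V - ?X) E"
    using conn XV small unfolding k_connected_def by blast
  have "\<not> \<Union>N \<subseteq> ?X" if "N \<in> M" for N
    using card_mono[OF finX, of "\<Union>N"] big[OF that] small by linarith
  then obtain v w where v: "v \<in> \<Union>K" "v \<notin> ?X" and w: "w \<in> \<Union>L" "w \<notin> ?X"
    using K L(1) by (meson subsetI)
  have wK: "w \<notin> \<Union>K" using w L by blast
  have "v \<in> V - ?X" "w \<in> V - ?X"
    using subsetD[OF sub[OF K] v(1)] v(2) subsetD[OF sub[OF L(1)] w(1)] w(2) by simp_all
  then have "(v, w) \<in> (adj_in (V - ?X) E)\<^sup>*"
    by (rule con[unfolded graph_connected_def, rule_format])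
  then have "w \<in> \<Union>K"
  proof (induction rule: rtrancl_induct)
    case base
    show ?case by (rule v(1))
  next
    case (step y z)
    then have yz: "y \<notin> ?X" "{y, z} \<in> E" unfolding adj_in_def by auto
    then obtain N where N: "N \<in> M" "{y, z} \<in> N" using cover by blast
    \<comment> \<open>Otherwise \<open>y\<close> would lie in two members of \<open>M\<close> and
      thus in the deleted set.\<close>
    then have "N = K" using yz(1) step.IH by blast
    then show ?case using N by blast
  qed
  with wK show False by blast
qed

section \<open>Combining the rank inequalities with the vertex count\<close>

theorem theorem5p4:
  fixes d :: nat and V :: "'a set" and E :: "'a set set"
  assumes "d \<ge> 1"
    and "simple_graph V E"
    and "k_connected (d+1) V E"
    and "redundantly_rigid d V E"
    and "M_separable d E"
  shows "(\<Sum>C\<in>M_components d E. dof d (\<Union>C) C) \<ge> int ((d+1) choose 2)"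
proof -
  let ?M = "M_components d E" and ?b = "(d + 1) choose 2"
  have finV: "finite V" and edges: "\<And>e. e \<in> E \<Longrightarrow> e \<subseteq> V \<and> card e = 2"
    using assms(2) unfolding simple_graph_def by auto
  have finE: "finite E"
    using edges finV by (intro finite_subset[of E "Pow V"]) auto
  have cardV: "card V \<ge> d + 2" using assms(3) unfolding k_connected_def by simp
  note M = M_components_props[OF finE, of d]
  have rank_minus: "rank_d d (E - {e}) + ?b = d * card V" if "e \<in> E" for e
  proof -
    have "rigid d V (E - {e})" using assms(4) that unfolding redundantly_rigid_def by blast
    then have "int (rank_d d (E - {e})) = int d * int (card V) - int ?b"
      using cardV unfolding rigid_def by simp
    then have "int (rank_d d (E - {e}) + ?b) = int (d * card V)" by simp
    then show ?thesis by (simp only: of_nat_eq_iff)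
  qed
  \<comment> \<open>With \<open>rank_minus\<close>, this upper bound shows that deleting an edge
    does not lower the rank, so no edge is a coloop.\<close>
  have rankE: "rank_d d E + ?b \<le> d * card V"
  proof -
    obtain B where B: "B \<subseteq> E" "R_indep d B" "card B = rank_d d E"
      using rank_d_attained[OF finE] by metis
    then show ?thesis using maxwell_bound[OF finV _ B(2)] cardV edges by auto
  qed
  have big: "d + 2 \<le> card (\<Union>K)" if K: "K \<in> ?M" for K
  proof -
    have "K \<noteq> {}" "K \<subseteq> E"
      using K in_quotient_imp_non_empty[OF equiv_M_rel[OF finE]] M(2)
      unfolding M_components_def by blast+
    then obtain e where e: "e \<in> K" "e \<in> E" by blast
    obtain B where B: "B \<subseteq> E - {e}" "R_indep d B" "card B = rank_d d (E - {e})"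
      using rank_d_attained[of "E - {e}" d] finE by auto
    then have "rank_d d (E - {e}) \<le> rank_d d E" using rank_d_ge[OF finE, of B d] by auto
    then have "rank_d d (E - {e}) = rank_d d E" using rank_minus[OF e(2)] rankE by linarith
    then obtain C where C: "C \<subseteq> E" "R_circuit d C" "e \<in> C"
      using non_coloop_in_circuit[OF finE e(2)] by blast
    then have "C \<subseteq> K" using circuit_in_component[OF finE K C(1,2)] e by blast
    have "d + 2 \<le> card (\<Union>C)"
    proof (rule ccontr)
      assume "\<not> ?thesis"
      then have "R_indep d C"
        using C(1) edges finite_subset[OF C(1) finE] by (intro R_indep_few_vertices) auto
      then show False using C(2) unfolding R_circuit_def by blast
    qed
    also have "card (\<Union>C) \<le> card (\<Union>K)"
    proof (rule card_mono)
      have "\<Union>K \<subseteq> V" using \<open>K \<subseteq> E\<close> edges by blast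
      then show "finite (\<Union>K)" using finV finite_subset by blast
      show "\<Union>C \<subseteq> \<Union>K" using \<open>C \<subseteq> K\<close> by blast
    qed
    finally show ?thesis .
  qed
  have other: "\<exists>L\<in>?M. L \<noteq> K" if "K \<in> ?M" for K
  proof (rule ccontr)
    assume "\<not> ?thesis"
    then have "E \<subseteq> K" using M(2) by blast
    moreover have "K \<in> E // M_rel d E" using that unfolding M_components_def .
    ultimately have "(e, f) \<in> M_rel d E" if "e \<in> E" "f \<in> E" for e f
      using that quotient_eq_iff[OF equiv_M_rel[OF finE], of K d K e f] by blast
    then show False using assms(5) unfolding M_separable_def by blast
  qed
  have cover: "V \<subseteq> (\<Union>K\<in>?M. \<Union>K)"
  proof
    fix u assume u: "u \<in> V"
    have "graph_connected V E"
      using assms(3) unfolding k_connected_def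
      by (metis Diff_empty card.empty empty_subsetI zero_less_Suc Suc_eq_plus1)
    moreover obtain v where "v \<in> V" "v \<noteq> u"
      using cardV u
      by (metis One_nat_def card_le_Suc0_iff_eq finV le_add2 le_trans not_less_eq_eq numeral_2_eq_2)
    ultimately have "u \<in> \<Union>E" using connected_vertex_in_edge[of V E u v] u by blast
    then show "u \<in> (\<Union>K\<in>?M. \<Union>K)" using M(2) by blast
  qed
  have "2 * card V + card ?M * (d + 1) \<le> 2 * (\<Sum>K\<in>?M. card (\<Union>K))"
  proof (rule sum_card_components_ge[OF finV M(1) _ cover])
    show "\<Union>K \<subseteq> V" if "K \<in> ?M" for K using that M(2) edges by blast
    show "d + 1 \<le> card {v \<in> \<Union>K. \<exists>L\<in>?M. L \<noteq> K \<and> v \<in> \<Union>L}" if "K \<in> ?M" for K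
      using other[OF that] shared_vertices_ge[OF assms(2,3) M(2) big that] by blast
  qed
  then have "d * (2 * card V + card ?M * (d + 1)) \<le> d * (2 * (\<Sum>K\<in>?M. card (\<Union>K)))"
    by (rule mult_le_mono2)
  \<comment> \<open>This identity turns the \<open>d + 1\<close> shared vertices per component,
    weighted by \<open>d\<close>, into two copies of the binomial coefficient.\<close>
  moreover have "d * (d + 1) = 2 * ?b"
    using choose_two[of "d + 1"] by (simp add: mult.commute)
  moreover have "d * (2 * card V + card ?M * (d + 1)) = 2 * (d * card V) + card ?M * (d * (d + 1))"
    by (simp add: algebra_simps)
  ultimately have "2 * (d * card V + card ?M * ?b) \<le> 2 * (d * (\<Sum>K\<in>?M. card (\<Union>K)))"
    by (simp only: distrib_left mult.left_commute[of _ 2])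
  then have "int (d * card V + card ?M * ?b) \<le> int (d * (\<Sum>K\<in>?M. card (\<Union>K)))"
    by (simp only: of_nat_le_iff) simp
  moreover have "int ((\<Sum>K\<in>?M. rank_d d K) + ?b) \<le> int (d * card V)"
    using sum_rank_components_le[OF finE, of d] rankE by (simp only: of_nat_le_iff)
  moreover have "(\<Sum>K\<in>?M. dof d (\<Union>K) K) =
      int (d * (\<Sum>K\<in>?M. card (\<Union>K))) - int (card ?M * ?b) - int (\<Sum>K\<in>?M. rank_d d K)"
    by (simp add: dof_def sum_subtractf sum_distrib_left)
  \<comment> \<open>The vertex count bounds the sum of \<open>dof\<close> below by
    \<open>d * card V\<close> minus the total rank of the components, and the rank inequality bounds
    this difference below by the binomial coefficient.\<close>
  ultimately show ?thesis by simp
qed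

end
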